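(* Let $X$ be a metric space and $Z$ a separable Banach space. If a multivalued function $G: X \to 2^Z$ is weakly upper semicontinuous, then $G$ is measurable with respect to the Borel $\sigma$-algebra $\mathcal{B}(X)$ of $X$.
   Context: $2^Z$ denotes the collection of all subsets of $Z$. Weak upper semicontinuity: for a metric space $X$ and a Banach space $Z$, a multivalued function $G: X\to 2^Z$ is weakly upper semicontinuous at $x_0\in X$ if for any sequence $x_n\to x_0$ in $X$ and any $z_n\in G(x_n)$ there exist $z_0\in G(x_0)$ and a subsequence $\{z_{n_k}\}$ of $\{z_n\}$ such that $z_{n_k}\rightharpoonup z_0$ weakly in $Z$. $G$ is weakly upper semicontinuous if this holds at every $x_0\in X$. Measurability: $G: X\to 2^Z$ is measurable with respect to $\mathcal{B}(X)$ if for every (norm-)open set $O\subseteq Z$ the inverse image $G^{-1}(O)=\{x\in X: G(x)\cap O\neq\emptyset\}$ belongs to $\mathcal{B}(X)$. *)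

theory Defs
  imports "HOL-Analysis.Analysis"
begin

(* Weak convergence is tested against the topological dual, i.e. all bounded real-linear
   functionals. *)
definition weakly_tendsto :: "(nat \<Rightarrow> 'z::real_normed_vector) \<Rightarrow> 'z \<Rightarrow> bool" where
  "weakly_tendsto z l \<longleftrightarrow>
     (\<forall>f :: 'z \<Rightarrow>\<^sub>L real. (\<lambda>n. blinfun_apply f (z n)) \<longlonglongrightarrow> blinfun_apply f l)"

(* Values of G may be empty, also at x0. *)
definition weakly_usc_at ::
    "('x::metric_space \<Rightarrow> 'z::real_normed_vector set) \<Rightarrow> 'x \<Rightarrow> bool" where
  "weakly_usc_at G x0 \<longleftrightarrow>
     (\<forall>(x :: nat \<Rightarrow> 'x) (z :: nat \<Rightarrow> 'z). x \<longlonglongrightarrow> x0 \<and> (\<forall>n. z n \<in> G (x n)) \<longrightarrow>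
        (\<exists>z0 \<in> G x0. \<exists>r :: nat \<Rightarrow> nat. strict_mono r \<and> weakly_tendsto (z \<circ> r) z0))"

definition weakly_usc :: "('x::metric_space \<Rightarrow> 'z::real_normed_vector set) \<Rightarrow> bool" where
  "weakly_usc G \<longleftrightarrow> (\<forall>x0. weakly_usc_at G x0)"

definition mv_measurable :: "'x measure \<Rightarrow> ('x \<Rightarrow> 'z::topological_space set) \<Rightarrow> bool" where
  "mv_measurable M G \<longleftrightarrow> (\<forall>U. open U \<longrightarrow> {x \<in> space M. G x \<inter> U \<noteq> {}} \<in> sets M)"

end

theory Submission
  imports Defs
begin

text \<open>
  A separable metric space has a countable base of closed balls in the sense that every open set
  \<open>U\<close> is the union of the countably many balls inside \<open>U\<close> with centre in a fixed countable dense
  set and radius of the form \<open>1 / (n + 1)\<close>. As \<open>U \<mapsto> {x. G x \<inter> U \<noteq> {}}\<close> commutes with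
  unions, it suffices to treat closed balls, and there the inverse image is even closed:
  if \<open>x\<^sub>n \<rightarrow> x\<^sub>0\<close> and \<open>z\<^sub>n \<in> G x\<^sub>n\<close> stay in the ball, then weak upper semicontinuity gives a weak
  limit point in \<open>G x\<^sub>0\<close>, and norm-closed balls are weakly sequentially closed
  (\<open>weakly_tendsto_in_cball\<close>).

  The last fact needs enough functionals: for every \<open>v\<close> one of norm at most \<open>1\<close> that takes the
  value \<open>norm v\<close> at \<open>v\<close> (\<open>norming_functional\<close>). This is the Hahn--Banach theorem. It is proved
  by Zorn's lemma on sublinear functions rather than on functionals defined on subspaces: a
  pointwise minimal sublinear function is linear, because otherwise its one-sided
  directional derivative at some point (\<open>tilt\<close>) would be a strictly smaller sublinear function.
\<close>

section \<open>Sublinear functions and the Hahn--Banach theorem\<close>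

definition sublinear :: "('a::real_vector \<Rightarrow> real) \<Rightarrow> bool" where
  "sublinear p \<longleftrightarrow> (\<forall>x y. p (x + y) \<le> p x + p y) \<and> (\<forall>t x. 0 \<le> t \<longrightarrow> p (t *\<^sub>R x) = t * p x)"

lemma sublinear_add: "sublinear p \<Longrightarrow> p (x + y) \<le> p x + p y"
  and sublinear_scale: "sublinear p \<Longrightarrow> 0 \<le> t \<Longrightarrow> p (t *\<^sub>R x) = t * p x"
  by (auto simp: sublinear_def)

lemma sublinear_zero: "sublinear p \<Longrightarrow> p 0 = 0"
  using sublinear_scale[of p 0 0] by simp

text \<open>One inequality of positive homogeneity suffices: the other one is the same inequality for the
  inverse scalar.\<close>

lemma sublinearI:
  assumes add: "\<And>x y. p (x + y) \<le> p x + p y"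
    and scale: "\<And>t x. 0 < t \<Longrightarrow> p (t *\<^sub>R x) \<le> t * p x"
    and zero: "p 0 = 0"
  shows "sublinear p"
proof -
  have "p (t *\<^sub>R x) = t * p x" if "0 \<le> t" for t x
  proof (cases "t = 0")
    case False
    with that have t: "0 < t" by simp
    have "p x \<le> inverse t * p (t *\<^sub>R x)"
      using scale[of "inverse t" "t *\<^sub>R x"] t by simp
    then have "t * p x \<le> p (t *\<^sub>R x)"
      using t by (simp add: field_simps)
    with scale[OF t, of x] show ?thesis by simp
  qed (simp add: zero)
  with add show ?thesis by (simp add: sublinear_def)
qed

lemma sublinear_minus_le:
  assumes "sublinear p" shows "- p (- x) \<le> p x"
  using sublinear_add[OF assms, of x "- x"] sublinear_zero[OF assms] by simp

text \<open>For sublinear \<open>p\<close> and \<open>t > 0\<close> the expression under the infimum is the difference quotient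
  \<open>(p (y + h *\<^sub>R x) - p y) / h\<close> with \<open>h = 1 / t\<close>. It decreases as \<open>h\<close> does, so that
  \<open>tilt p y x\<close> is the one-sided derivative of \<open>p\<close> at \<open>y\<close> in the direction \<open>x\<close>.\<close>

definition tilt :: "('a::real_vector \<Rightarrow> real) \<Rightarrow> 'a \<Rightarrow> 'a \<Rightarrow> real" where
  "tilt p y x = (INF t\<in>{0..}. p (x + t *\<^sub>R y) - t * p y)"

lemma tilt_le:
  assumes p: "sublinear p" and t: "0 \<le> t"
  shows "tilt p y x \<le> p (x + t *\<^sub>R y) - t * p y"
  unfolding tilt_def
proof (rule cINF_lower)
  have "- p (- x) \<le> p (x + s *\<^sub>R y) - s * p y" if "0 \<le> s" for s
    using sublinear_add[OF p, of "x + s *\<^sub>R y" "- x"] sublinear_scale[OF p that, of y] by simp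
  then show "bdd_below ((\<lambda>s. p (x + s *\<^sub>R y) - s * p y) ` {0..})"
    by (auto intro!: bdd_belowI2)
qed (use t in simp)

lemma tilt_greatest:
  assumes "\<And>t. 0 \<le> t \<Longrightarrow> c \<le> p (x + t *\<^sub>R y) - t * p y"
  shows "c \<le> tilt p y x"
  unfolding tilt_def by (rule cINF_greatest) (use assms in auto)

lemma tilt_le_self: "sublinear p \<Longrightarrow> tilt p y x \<le> p x"
  using tilt_le[of p 0 y x] by simp

lemma sublinear_tilt:
  assumes p: "sublinear p"
  shows "sublinear (tilt p y)"
proof (rule sublinearI)
  fix x x'
  have split: "tilt p y (x + x') \<le> (p (x + s *\<^sub>R y) - s * p y) + (p (x' + t *\<^sub>R y) - t * p y)"
    if "0 \<le> s" "0 \<le> t" for s t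
  proof -
    have "tilt p y (x + x') \<le> p ((x + x') + (s + t) *\<^sub>R y) - (s + t) * p y"
      using that by (intro tilt_le[OF p]) simp
    also have "(x + x') + (s + t) *\<^sub>R y = (x + s *\<^sub>R y) + (x' + t *\<^sub>R y)"
      by (simp add: algebra_simps)
    finally show ?thesis
      using sublinear_add[OF p, of "x + s *\<^sub>R y" "x' + t *\<^sub>R y"] by (simp add: algebra_simps)
  qed
  have "tilt p y (x + x') - tilt p y x' \<le> tilt p y x"
  proof (rule tilt_greatest)
    fix s :: real
    assume s: "0 \<le> s"
    have "tilt p y (x + x') - (p (x + s *\<^sub>R y) - s * p y) \<le> tilt p y x'"
    proof (rule tilt_greatest)
      fix t :: real
      assume "0 \<le> t"
      from split[OF s this]
      show "tilt p y (x + x') - (p (x + s *\<^sub>R y) - s * p y) \<le> p (x' + t *\<^sub>R y) - t * p y"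
        by simp
    qed
    then show "tilt p y (x + x') - tilt p y x' \<le> p (x + s *\<^sub>R y) - s * p y"
      by simp
  qed
  then show "tilt p y (x + x') \<le> tilt p y x + tilt p y x'"
    by simp
next
  fix t :: real and x
  assume t: "0 < t"
  have "tilt p y (t *\<^sub>R x) / t \<le> tilt p y x"
  proof (rule tilt_greatest)
    fix s :: real
    assume "0 \<le> s"
    with t have "tilt p y (t *\<^sub>R x) \<le> p (t *\<^sub>R x + (t * s) *\<^sub>R y) - (t * s) * p y"
      by (intro tilt_le[OF p]) simp
    also have "t *\<^sub>R x + (t * s) *\<^sub>R y = t *\<^sub>R (x + s *\<^sub>R y)"
      by (simp add: algebra_simps)
    also have "p \<dots> = t * p (x + s *\<^sub>R y)"
      using t by (intro sublinear_scale[OF p]) simp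
    finally show "tilt p y (t *\<^sub>R x) / t \<le> p (x + s *\<^sub>R y) - s * p y"
      using t by (simp add: field_simps)
  qed
  with t show "tilt p y (t *\<^sub>R x) \<le> t * tilt p y x"
    by (simp add: field_simps)
next
  have "0 \<le> tilt p y 0"
    by (rule tilt_greatest) (simp add: sublinear_scale[OF p])
  with tilt_le_self[OF p, of y 0] show "tilt p y 0 = 0"
    by (simp add: sublinear_zero[OF p])
qed

text \<open>Sublinearity gives \<open>p (x + y) \<le> p x + p y\<close>. Minimality gives the reverse inequality, since it
  forces \<open>p = tilt p y\<close>, and the parameter \<open>t = 1\<close> in the infimum bounds the latter
  by \<open>p (x + y) - p y\<close>.\<close>

lemma minimal_sublinear_linear:
  assumes p: "sublinear p" and minimal: "\<And>q. sublinear q \<Longrightarrow> q \<le> p \<Longrightarrow> q = p"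
  shows "linear p"
proof -
  have add: "p (x + y) = p x + p y" for x y
  proof -
    have "tilt p y = p"
      by (rule minimal) (auto simp: le_fun_def sublinear_tilt[OF p] tilt_le_self[OF p])
    then have "p x \<le> p (x + y) - p y"
      using tilt_le[OF p, of 1 y x] by simp
    with sublinear_add[OF p, of x y] show ?thesis by simp
  qed
  have neg: "p (- x) = - p x" for x
    using add[of x "- x"] sublinear_zero[OF p] by simp
  show ?thesis
  proof (rule linearI)
    fix t x
    show "p (t *\<^sub>R x) = t *\<^sub>R p x"
    proof (cases "0 \<le> t")
      case False
      then have "p ((- t) *\<^sub>R x) = - t * p x"
        by (intro sublinear_scale[OF p]) simp
      then show ?thesis by (simp add: neg)
    qed (simp add: sublinear_scale[OF p])
  qed (rule add)
qed

text \<open>The infimum of two elements of a chain is one of them, which is what makes the infimum of a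
  chain subadditive. It is finite because all sublinear \<open>q \<le> p\<close> share the lower bound
  \<open>- p (- x) \<le> - q (- x) \<le> q x\<close>.\<close>

lemma sublinear_chain_Inf:
  assumes "C \<noteq> {}" and sub: "\<And>q. q \<in> C \<Longrightarrow> sublinear q" and le: "\<And>q. q \<in> C \<Longrightarrow> q \<le> p"
    and chain: "\<And>q r. q \<in> C \<Longrightarrow> r \<in> C \<Longrightarrow> q \<le> r \<or> r \<le> q"
  obtains u where "sublinear u" "\<And>q. q \<in> C \<Longrightarrow> u \<le> q"
proof -
  define u where "u x = (INF q\<in>C. q x)" for x
  have lower: "u x \<le> q x" if "q \<in> C" for q x
    unfolding u_def
  proof (rule cINF_lower[OF _ that])
    have "- p (- x) \<le> r x" if "r \<in> C" for r
      using sublinear_minus_le[OF sub[OF that], of x] le_funD[OF le[OF that], of "- x"] by simp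
    then show "bdd_below ((\<lambda>r. r x) ` C)"
      by (auto intro!: bdd_belowI2)
  qed
  have greatest: "c \<le> u x" if "\<And>q. q \<in> C \<Longrightarrow> c \<le> q x" for c x
    unfolding u_def by (rule cINF_greatest) (use that \<open>C \<noteq> {}\<close> in auto)
  have "sublinear u"
  proof (rule sublinearI)
    fix x y
    have split: "u (x + y) \<le> q x + r y" if qr: "q \<in> C" "r \<in> C" for q r
    proof -
      obtain m where m: "m \<in> C" "m \<le> q" "m \<le> r"
        using chain[OF qr] qr by blast
      show ?thesis
        using lower[OF m(1), of "x + y"] sublinear_add[OF sub[OF m(1)], of x y]
          le_funD[OF m(2), of x] le_funD[OF m(3), of y] by simp
    qed
    have "u (x + y) - u y \<le> u x"
    proof (rule greatest)
      fix q
      assume q: "q \<in> C"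
      have "u (x + y) - q x \<le> u y"
      proof (rule greatest)
        fix r
        assume "r \<in> C"
        from split[OF q this] show "u (x + y) - q x \<le> r y"
          by simp
      qed
      then show "u (x + y) - u y \<le> q x"
        by simp
    qed
    then show "u (x + y) \<le> u x + u y"
      by simp
  next
    fix t :: real and x
    assume t: "0 < t"
    have "u (t *\<^sub>R x) / t \<le> u x"
    proof (rule greatest)
      fix q
      assume "q \<in> C"
      then show "u (t *\<^sub>R x) / t \<le> q x"
        using lower[of q "t *\<^sub>R x"] sublinear_scale[OF sub, of q t x] t by (simp add: field_simps)
    qed
    with t show "u (t *\<^sub>R x) \<le> t * u x"
      by (simp add: field_simps)
  next
    show "u 0 = 0"
      using \<open>C \<noteq> {}\<close> by (simp add: u_def sublinear_zero[OF sub])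
  qed
  with lower show thesis
    by (auto intro: that simp: le_fun_def)
qed

lemma linear_below_sublinear:
  assumes p: "sublinear p"
  obtains f where "linear f" "f \<le> p"
proof -
  define A where "A = {q. sublinear q \<and> q \<le> p}"
  have "\<exists>m\<in>A. \<forall>q\<in>A. q \<le> m \<longrightarrow> q = m"
  proof (rule predicate_Zorn)
    show "partial_order_on A (relation_of (\<ge>) A)"
      by (rule partial_order_on_relation_ofI) auto
  next
    fix C
    assume C: "C \<in> Chains (relation_of (\<ge>) A)"
    then have "C \<subseteq> A" and chain: "\<And>q r. q \<in> C \<Longrightarrow> r \<in> C \<Longrightarrow> q \<le> r \<or> r \<le> q"
      by (auto simp: Chains_def relation_of_def)
    show "\<exists>u\<in>A. \<forall>q\<in>C. u \<le> q"
    proof (cases "C = {}")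
      case True
      with p show ?thesis by (auto simp: A_def)
    next
      case False
      obtain u where u: "sublinear u" "\<And>q. q \<in> C \<Longrightarrow> u \<le> q"
        using sublinear_chain_Inf[of C p] False chain \<open>C \<subseteq> A\<close> unfolding A_def by blast
      from False obtain q where "q \<in> C" by blast
      with u(2) \<open>C \<subseteq> A\<close> have "u \<le> p"
        unfolding A_def by (blast intro: order_trans)
      with u show ?thesis by (auto simp: A_def)
    qed
  qed
  then obtain m where m: "sublinear m" "m \<le> p" and min: "\<And>q. q \<in> A \<Longrightarrow> q \<le> m \<Longrightarrow> q = m"
    by (auto simp: A_def)
  have "linear m"
    using m by (intro minimal_sublinear_linear min) (auto simp: A_def intro: order_trans)
  with m(2) show thesis by (rule that[rotated -1])
qed

text \<open>A linear \<open>f \<le> tilt p v\<close> satisfies \<open>f (- v) \<le> - p v\<close>, by the parameter \<open>t = 1\<close> in the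
  infimum. So \<open>f\<close> attains \<open>p\<close> at \<open>v\<close>.\<close>

theorem hahn_banach_sublinear:
  assumes p: "sublinear p"
  obtains f where "linear f" "f \<le> p" "f v = p v"
proof -
  obtain f where f: "linear f" "f \<le> tilt p v"
    using linear_below_sublinear[OF sublinear_tilt[OF p]] .
  have le: "f x \<le> p x" for x
    using le_funD[OF f(2), of x] tilt_le_self[OF p, of v x] by simp
  have "tilt p v (- v) \<le> - p v"
    using tilt_le[OF p, of 1 v "- v"] sublinear_zero[OF p] by simp
  then have "p v \<le> f v"
    using le_funD[OF f(2), of "- v"] linear_neg[OF f(1), of v] by simp
  with le[of v] have "f v = p v" by simp
  with f(1) le show thesis by (auto intro: that simp: le_fun_def)
qed

corollary norming_functional:
  fixes v :: "'a::real_normed_vector"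
  obtains f :: "'a \<Rightarrow>\<^sub>L real" where "\<And>x. blinfun_apply f x \<le> norm x" "blinfun_apply f v = norm v"
proof -
  have "sublinear (norm :: 'a \<Rightarrow> real)"
    by (simp add: sublinear_def norm_triangle_ineq)
  then obtain g :: "'a \<Rightarrow> real" where g: "linear g" "g \<le> norm" "g v = norm v"
    by (rule hahn_banach_sublinear)
  have le: "g x \<le> norm x" for x
    using le_funD[OF g(2)] .
  have "\<bar>g x\<bar> \<le> norm x" for x
    using le[of x] le[of "- x"] linear_neg[OF g(1), of x] by simp
  then have "bounded_linear g"
    using g(1) by (intro bounded_linear_intro[where K = 1]) (auto simp: linear_add linear_scale)
  then have "blinfun_apply (Blinfun g) = g"
    by (rule bounded_linear_Blinfun_apply)
  with le g(3) show thesis by (auto intro: that[of "Blinfun g"])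
qed

section \<open>Weak limits and inverse images of closed balls\<close>

text \<open>Testing the weak convergence against a functional that norms \<open>l - c\<close> bounds
  \<open>norm (l - c)\<close>.\<close>

lemma weakly_tendsto_in_cball:
  assumes lim: "weakly_tendsto z l" and z: "\<And>n. z n \<in> cball c r"
  shows "l \<in> cball c r"
proof -
  obtain f :: "'a \<Rightarrow>\<^sub>L real"
    where f: "\<And>x. blinfun_apply f x \<le> norm x" "blinfun_apply f (l - c) = norm (l - c)"
    using norming_functional[of "l - c"] by blast
  have "(\<lambda>n. blinfun_apply f (z n)) \<longlonglongrightarrow> blinfun_apply f l"
    using lim by (simp add: weakly_tendsto_def)
  moreover have "blinfun_apply f (z n) \<le> blinfun_apply f c + r" for n
    using f(1)[of "z n - c"] z[of n] by (simp add: blinfun.diff_right dist_norm norm_minus_commute)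
  ultimately have "blinfun_apply f l \<le> blinfun_apply f c + r"
    by (intro LIMSEQ_le_const2) auto
  with f(2) show ?thesis
    by (simp add: blinfun.diff_right dist_norm norm_minus_commute)
qed

lemma weakly_usc_closed_cball_inverse:
  assumes "weakly_usc G"
  shows "closed {x. G x \<inter> cball c r \<noteq> {}}"
  unfolding closed_sequential_limits
proof (intro allI impI, elim conjE)
  fix x x0
  assume "\<forall>n. x n \<in> {x. G x \<inter> cball c r \<noteq> {}}" and x: "x \<longlonglongrightarrow> x0"
  then have "\<forall>n. \<exists>z. z \<in> G (x n) \<and> z \<in> cball c r"
    by blast
  then obtain z where z: "\<And>n. z n \<in> G (x n)" "\<And>n. z n \<in> cball c r"
    by metis
  have "weakly_usc_at G x0"
    using assms by (simp add: weakly_usc_def)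
  with x z(1) obtain z0 s where "z0 \<in> G x0" "weakly_tendsto (z \<circ> s) z0"
    unfolding weakly_usc_at_def by blast
  moreover from this(2) have "z0 \<in> cball c r"
    by (rule weakly_tendsto_in_cball) (simp only: o_apply z(2))
  ultimately show "x0 \<in> {x. G x \<inter> cball c r \<noteq> {}}"
    by blast
qed

section \<open>Measurability\<close>

lemma open_eq_Union_cball:
  fixes U D :: "'a::metric_space set"
  assumes "open U" and dense: "closure D = UNIV"
  shows "U = (\<Union>(d, n) \<in> {(d, n). d \<in> D \<and> cball d (1 / Suc n) \<subseteq> U}. cball d (1 / Suc n))"
    (is "U = ?V")
proof
  show "U \<subseteq> ?V"
  proof
    fix u
    assume "u \<in> U"
    with \<open>open U\<close> obtain e where e: "0 < e" "ball u e \<subseteq> U"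
      by (meson open_contains_ball)
    \<comment> \<open>A ball of radius below \<open>e / 2\<close> that contains \<open>u\<close> lies in \<open>ball u e\<close>.\<close>
    obtain n where n: "1 / Suc n < e / 2"
      using nat_approx_posE[of "e / 2"] e(1) by auto
    have "u \<in> closure D" using dense by simp
    then obtain d where d: "d \<in> D" "dist d u < 1 / Suc n"
      unfolding closure_approachable by (meson of_nat_0_less_iff zero_less_Suc zero_less_divide_1_iff)
    have "cball d (1 / Suc n) \<subseteq> ball u e"
    proof
      fix w
      assume "w \<in> cball d (1 / Suc n)"
      then show "w \<in> ball u e"
        using dist_triangle[of u w d] d(2) n by (simp add: dist_commute)
    qed
    with e(2) d show "u \<in> ?V"
      by (auto intro!: exI[of _ d] exI[of _ n])
  qed
qed auto

theorem theorem2p3: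
  fixes G :: "'x::metric_space \<Rightarrow> 'z::banach set"
  assumes "separable_space (euclidean :: 'z topology)"
    and "weakly_usc G"
  shows "mv_measurable (borel :: 'x measure) G"
  unfolding mv_measurable_def
proof (intro allI impI)
  fix U :: "'z set"
  assume U: "open U"
  obtain D :: "'z set" where D: "countable D" "closure D = UNIV"
    using assms(1) by (auto simp: separable_space_def)
  define I where "I = {(d, n :: nat). d \<in> D \<and> cball d (1 / Suc n) \<subseteq> U}"
  have "I \<subseteq> D \<times> UNIV"
    by (auto simp: I_def)
  then have "countable I"
    by (rule countable_subset) (simp add: D(1))
  have "U = (\<Union>(d, n)\<in>I. cball d (1 / Suc n))"
    using open_eq_Union_cball[OF U D(2)] by (simp add: I_def)
  then have "{x. G x \<inter> U \<noteq> {}} = (\<Union>(d, n)\<in>I. {x. G x \<inter> cball d (1 / Suc n) \<noteq> {}})"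
    by blast
  also have "\<dots> \<in> sets borel"
    using \<open>countable I\<close> weakly_usc_closed_cball_inverse[OF assms(2)]
    by (intro sets.countable_UN') (auto intro!: borel_closed)
  finally show "{x \<in> space borel. G x \<inter> U \<noteq> {}} \<in> sets (borel :: 'x measure)"
    by simp
qed

end
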